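(* For a commutative semigroup $X$ the following conditions are equivalent: (1) the semigroup $\lambda^\bullet(X)$ is commutative; (2) any two maximal linked systems $\mathcal A,\mathcal B\in\lambda^\bullet_3(X)$ commute; (3) any two maximal linked systems $\mathcal A\in\lambda^\bullet(X)$ and $\mathcal B\in\lambda(X)$ commute; (4) for any elements $a,b,c,x,y,z\in X$ the sets $\{ax,ay,cy,cz\}$ and $\{xc,xb,za,zb\}$ are not disjoint; (5) for any elements $x_0,x_1,x_2,x_3,x_4,x_5\in X$ the sets $\{x_1x_2,x_2x_3,x_3x_4,x_4x_5\}$ and $\{x_1x_4,x_2x_5,x_0x_1,x_0x_5\}$ are not disjoint.
   Context: An upfamily on a nonempty set $X$ is a nonempty family $\mathcal F$ of nonempty subsets of $X$ such that $F\in\mathcal F$ and $F\subset E\subset X$ imply $E\in\mathcal F$; $\upsilon(X)$ is the set of all upfamilies on $X$. A family $\mathcal G$ of nonempty subsets of $X$ generates the upfamily $\langle G:G\in\mathcal G\rangle=\{E\subset X:\exists G\in\mathcal G,\ G\subset E\}$. An upfamily $\mathcal F$ is linked if $A\cap B\ne\emptyset$ for all $A,B\in\mathcal F$; it is maximal linked (a maximal linked system) if it is linked and coincides with every linked upfamily containing it. $\lambda(X)$ is the set of maximal linked upfamilies. An upfamily is finitely supported if it equals $\langle F_1,\dots,F_n\rangle$ for some (finitely many, at least one) nonempty finite sets $F_i\subset X$; $\lambda^\bullet(X)$ is the set of finitely supported maximal linked upfamilies. For $Y\subset X$, $\lambda(Y)$ is identified with a subset of $\lambda(X)$ via $\mathcal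 F\mapsto\{A\subset X:A\cap Y\in\mathcal F\}$, and $\lambda^\bullet_3(X)=\{\mathcal A\in\lambda(X):\exists Y\subset X \text{ with } |Y|\le3 \text{ and } \mathcal A\in\lambda(Y)\subset\lambda(X)\}\subset\lambda^\bullet(X)$. If $X$ is a semigroup, put for $\mathcal A,\mathcal B\in\upsilon(X)$: $\mathcal A*\mathcal B=\langle\bigcup_{a\in A}aB_a: A\in\mathcal A,\ (B_a)_{a\in A}\in\mathcal B^A\rangle$. The operation $*$ is associative and $\lambda(X)$, $\lambda^\bullet(X)$ are subsemigroups of $(\upsilon(X),* )$. Upfamilies $\mathcal A,\mathcal B$ commute if $\mathcal A*\mathcal B=\mathcal B*\mathcal A$; commutativity of $\lambda^\bullet(X)$ refers to $*$. *)

theory Defs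
  imports Main "HOL-Library.FuncSet"
begin

text \<open>
  Families of subsets are taken relative to an explicit ground set, because the maximal linked
  systems on a subset \<open>Y\<close> of \<open>X\<close> are needed as well as those on \<open>X\<close>.
  There are no upfamilies on the empty set.
\<close>

definition upfamilies :: "'a set \<Rightarrow> 'a set set set" where
  "upfamilies X = {\<F>. \<F> \<noteq> {} \<and> (\<forall>F\<in>\<F>. F \<noteq> {} \<and> F \<subseteq> X) \<and>
     (\<forall>F\<in>\<F>. \<forall>E. F \<subseteq> E \<and> E \<subseteq> X \<longrightarrow> E \<in> \<F>)}"

definition upfamily_generated :: "'a set \<Rightarrow> 'a set set \<Rightarrow> 'a set set" where
  "upfamily_generated X \<G> = {E. E \<subseteq> X \<and> (\<exists>G\<in>\<G>. G \<subseteq> E)}"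

definition linked :: "'a set set \<Rightarrow> bool" where
  "linked \<F> \<longleftrightarrow> (\<forall>A\<in>\<F>. \<forall>B\<in>\<F>. A \<inter> B \<noteq> {})"

definition max_linked :: "'a set \<Rightarrow> 'a set set set" where
  "max_linked X = {\<F> \<in> upfamilies X. linked \<F> \<and>
     (\<forall>\<G> \<in> upfamilies X. linked \<G> \<and> \<F> \<subseteq> \<G> \<longrightarrow> \<F> = \<G>)}"

definition finitely_supported :: "'a set \<Rightarrow> 'a set set \<Rightarrow> bool" where
  "finitely_supported X \<F> \<longleftrightarrow>
     (\<exists>\<G>. finite \<G> \<and> \<G> \<noteq> {} \<and> (\<forall>G\<in>\<G>. finite G \<and> G \<noteq> {} \<and> G \<subseteq> X) \<and>
        \<F> = upfamily_generated X \<G>)"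

definition max_linked_fin :: "'a set \<Rightarrow> 'a set set set" where
  "max_linked_fin X = {\<F> \<in> max_linked X. finitely_supported X \<F>}"

text \<open>The identification of families on \<open>Y \<subseteq> X\<close> with families on \<open>X\<close>:\<close>

definition extend_family :: "'a set \<Rightarrow> 'a set \<Rightarrow> 'a set set \<Rightarrow> 'a set set" where
  "extend_family X Y \<F> = {A. A \<subseteq> X \<and> A \<inter> Y \<in> \<F>}"

definition max_linked_3 :: "'a set \<Rightarrow> 'a set set set" where
  "max_linked_3 X = {\<A> \<in> max_linked X.
     \<exists>Y. Y \<subseteq> X \<and> finite Y \<and> card Y \<le> 3 \<and> \<A> \<in> extend_family X Y ` max_linked Y}"

text \<open>The extension of the multiplication to upfamilies on the whole type. Only the values of
  \<open>B\<close> on \<open>A\<close> matter.\<close>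

definition upfamily_mult :: "'a::times set set \<Rightarrow> 'a set set \<Rightarrow> 'a set set"
    (infixl \<open>\<star>\<close> 70) where
  "\<A> \<star> \<B> = upfamily_generated UNIV
     {(\<Union>a\<in>A. (\<lambda>b. a * b) ` B a) | A B. A \<in> \<A> \<and> B \<in> A \<rightarrow> \<B>}"

definition all_equivalent :: "bool list \<Rightarrow> bool" where
  "all_equivalent Ps \<longleftrightarrow> (\<forall>P\<in>set Ps. \<forall>Q\<in>set Ps. P \<longleftrightarrow> Q)"

end

theory Submission
  imports Defs
begin

text \<open>
  For upfamilies, \<open>U \<in> \<A> \<star> \<B>\<close> says that for \<open>\<A>\<close>-many \<open>a\<close> and \<open>\<B>\<close>-many \<open>b\<close> the product
  \<open>a * b\<close> lies in \<open>U\<close>. If (4) fails, the majority systems of \<open>a, b, c\<close> and of \<open>x, y, z\<close> have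
  products in the two orders that contain disjoint sets, so they do not commute. Conversely, if
  \<open>\<A>\<close> and \<open>\<B>\<close> do not commute, some \<open>U\<close> lies in \<open>\<A> \<star> \<B>\<close> with complement in \<open>\<B> \<star> \<A>\<close>. Then
  \<open>\<A>\<close> has a finite member \<open>F\<close> consisting of \<open>a\<close> with \<open>a * b \<in> U\<close> for \<open>\<B>\<close>-many \<open>b\<close>, and an
  \<open>x\<close> for which the trace on \<open>F\<close> of \<open>{a. a * x \<notin> U}\<close> is as small as possible leads to a
  violation of (4).
\<close>

section \<open>Maximal linked systems and complements\<close>

lemma upfamiliesD_mono: "\<lbrakk>\<F> \<in> upfamilies X; A \<in> \<F>; A \<subseteq> B; B \<subseteq> X\<rbrakk> \<Longrightarrow> B \<in> \<F>"
  unfolding upfamilies_def by blast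

lemma max_linked_imp_upfamilies: "\<F> \<in> max_linked X \<Longrightarrow> \<F> \<in> upfamilies X"
  unfolding max_linked_def by blast

lemma max_linked_Int_nonempty: "\<lbrakk>\<F> \<in> max_linked X; A \<in> \<F>; B \<in> \<F>\<rbrakk> \<Longrightarrow> A \<inter> B \<noteq> {}"
  unfolding max_linked_def linked_def by blast

text \<open>A set \<open>E\<close> in a larger linked upfamily cannot have its complement in
  \<open>\<F>\<close>, since the two are disjoint; hence \<open>E\<close> already belongs to
  \<open>\<F>\<close>.\<close>

lemma max_linkedI:
  assumes "\<F> \<in> upfamilies X" "linked \<F>" and dec: "\<And>E. E \<subseteq> X \<Longrightarrow> E \<in> \<F> \<or> X - E \<in> \<F>"
  shows "\<F> \<in> max_linked X"
proof -
  have "\<G> \<subseteq> \<F>" if "\<G> \<in> upfamilies X" "linked \<G>" "\<F> \<subseteq> \<G>" for \<G>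
  proof
    fix E assume E: "E \<in> \<G>"
    have "E \<subseteq> X" using E that(1) unfolding upfamilies_def by blast
    moreover have "X - E \<notin> \<F>"
    proof
      assume "X - E \<in> \<F>"
      then have "E \<inter> (X - E) \<noteq> {}" using E that(2,3) unfolding linked_def by blast
      then show False by blast
    qed
    ultimately show "E \<in> \<F>" using dec by blast
  qed
  then show ?thesis using assms(1,2) unfolding max_linked_def by blast
qed

text \<open>If every member met \<open>E\<close>, adjoining all supersets of \<open>E\<close> would
  give a strictly larger linked upfamily. So some member misses \<open>E\<close>, and monotonicity
  does the rest.\<close>

lemma max_linked_Diff_mem:
  assumes \<F>: "\<F> \<in> max_linked X" and E: "E \<subseteq> X" "E \<notin> \<F>"
  shows "X - E \<in> \<F>"
proof -
  have up: "\<F> \<in> upfamilies X" using \<F> by (rule max_linked_imp_upfamilies)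
  have "\<exists>A\<in>\<F>. A \<inter> E = {}"
  proof (rule ccontr)
    assume "\<not> (\<exists>A\<in>\<F>. A \<inter> E = {})"
    then have meets: "A \<inter> E \<noteq> {}" if "A \<in> \<F>" for A using that by blast
    define \<G> where "\<G> = \<F> \<union> {S. E \<subseteq> S \<and> S \<subseteq> X}"
    \<comment> \<open>\<open>\<F>\<close> has a member, and that member meets \<open>E\<close>. This
      keeps the empty set out of \<open>\<G>\<close>.\<close>
    have "E \<noteq> {}" using up meets unfolding upfamilies_def by blast
    then have "\<G> \<in> upfamilies X" using up unfolding \<G>_def upfamilies_def mem_Collect_eq
      by (intro conjI ballI allI impI) blast+
    moreover have "linked \<G>"
      unfolding linked_def
    proof (intro ballI)
      fix A B assume "A \<in> \<G>" "B \<in> \<G>"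
      then consider "A \<in> \<F>" "B \<in> \<F>" | "A \<in> \<F>" "E \<subseteq> B" | "E \<subseteq> A" "B \<in> \<F>" | "E \<subseteq> A" "E \<subseteq> B"
        unfolding \<G>_def by blast
      then show "A \<inter> B \<noteq> {}"
        using max_linked_Int_nonempty[OF \<F>] meets \<open>E \<noteq> {}\<close> by cases blast+
    qed
    ultimately have "\<F> = \<G>" using \<F> unfolding max_linked_def \<G>_def by blast
    then show False using E unfolding \<G>_def by blast
  qed
  then obtain A where "A \<in> \<F>" "A \<inter> E = {}" by blast
  moreover from this have "A \<subseteq> X - E" using up unfolding upfamilies_def by blast
  ultimately show ?thesis using upfamiliesD_mono[OF up] by blast
qed

lemma max_linked_Compl_mem_iff:
  assumes "\<F> \<in> max_linked UNIV"
  shows "- E \<in> \<F> \<longleftrightarrow> E \<notin> \<F>"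
  using max_linked_Int_nonempty[OF assms, of E "- E"] max_linked_Diff_mem[OF assms, of E]
  by (auto simp: Compl_eq_Diff_UNIV)

section \<open>The product as an iterated quantifier\<close>

lemma mem_upfamily_mult_iff:
  assumes A: "\<A> \<in> upfamilies UNIV" and B: "\<B> \<in> upfamilies UNIV"
  shows "E \<in> \<A> \<star> \<B> \<longleftrightarrow> {a. {b. a * b \<in> E} \<in> \<B>} \<in> \<A>"
proof
  assume "E \<in> \<A> \<star> \<B>"
  then obtain S T where ST: "S \<in> \<A>" "T \<in> S \<rightarrow> \<B>" "(\<Union>a\<in>S. (\<lambda>b. a * b) ` T a) \<subseteq> E"
    unfolding upfamily_mult_def upfamily_generated_def by blast
  have "{b. a * b \<in> E} \<in> \<B>" if "a \<in> S" for a
  proof (rule upfamiliesD_mono[OF B])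
    show "T a \<in> \<B>" using ST(2) that by blast
    show "T a \<subseteq> {b. a * b \<in> E}" using ST(3) that by blast
  qed simp
  then have "S \<subseteq> {a. {b. a * b \<in> E} \<in> \<B>}" by blast
  then show "{a. {b. a * b \<in> E} \<in> \<B>} \<in> \<A>"
    using upfamiliesD_mono[OF A ST(1)] by blast
next
  \<comment> \<open>The largest admissible index set and the largest admissible fibres serve as the
    generating data.\<close>
  let ?S = "{a. {b. a * b \<in> E} \<in> \<B>}" and ?T = "\<lambda>a. {b. a * b \<in> E}"
  assume "?S \<in> \<A>"
  moreover have "?T \<in> ?S \<rightarrow> \<B>" by blast
  moreover have "(\<Union>a\<in>?S. (\<lambda>b. a * b) ` ?T a) \<subseteq> E" by blast
  ultimately show "E \<in> \<A> \<star> \<B>"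
    unfolding upfamily_mult_def upfamily_generated_def mem_Collect_eq
    by (intro conjI subset_UNIV bexI[of _ "\<Union>a\<in>?S. (\<lambda>b. a * b) ` ?T a"] CollectI
        exI[of _ ?S] exI[of _ ?T]) auto
qed

text \<open>Each factor is self-dual under complements, so a negation passes through both
  quantifiers of the product.\<close>

lemma Compl_mem_upfamily_mult_iff:
  assumes A: "\<A> \<in> max_linked UNIV" and B: "\<B> \<in> max_linked UNIV"
  shows "- E \<in> \<A> \<star> \<B> \<longleftrightarrow> E \<notin> \<A> \<star> \<B>"
proof -
  have "{b. a * b \<in> - E} = - {b. a * b \<in> E}" for a by blast
  then have "{a. {b. a * b \<in> - E} \<in> \<B>} = - {a. {b. a * b \<in> E} \<in> \<B>}"
    using max_linked_Compl_mem_iff[OF B] by auto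
  then show ?thesis
    using max_linked_Compl_mem_iff[OF A]
    by (simp add: mem_upfamily_mult_iff max_linked_imp_upfamilies A B)
qed

section \<open>Finite supports and majority systems\<close>

lemma max_linked_fin_finite_subset:
  assumes "\<A> \<in> max_linked_fin X" "E \<in> \<A>"
  obtains F where "finite F" "F \<subseteq> E" "F \<in> \<A>"
  using assms unfolding max_linked_fin_def finitely_supported_def upfamily_generated_def by blast

text \<open>The points may coincide: a repeated point turns the system into the principal
  ultrafilter at that point, so degenerate triples need no separate treatment.\<close>

definition majority :: "'a set \<Rightarrow> 'a \<Rightarrow> 'a \<Rightarrow> 'a \<Rightarrow> 'a set set" where
  "majority X a b c = {E. E \<subseteq> X \<and> (a \<in> E \<and> b \<in> E \<or> b \<in> E \<and> c \<in> E \<or> a \<in> E \<and> c \<in> E)}"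

text \<open>Two pairs chosen from three labels share a label, which gives linkedness; of three
  points, two lie on the same side of any \<open>E\<close>, which decides \<open>E\<close>.\<close>

lemma majority_max_linked:
  assumes "a \<in> X" "b \<in> X" "c \<in> X"
  shows "majority X a b c \<in> max_linked X"
proof (rule max_linkedI)
  have "X \<in> majority X a b c" using assms unfolding majority_def by blast
  then show "majority X a b c \<in> upfamilies X"
    unfolding upfamilies_def by (auto simp: majority_def)
  show "linked (majority X a b c)"
    unfolding linked_def majority_def by blast
  show "E \<in> majority X a b c \<or> X - E \<in> majority X a b c" if "E \<subseteq> X" for E
    using assms that unfolding majority_def by blast
qed

lemma majority_max_linked_3: "majority UNIV a b c \<in> max_linked_3 UNIV"
proof -
  let ?Y = "{a, b, c}"
  have "?Y \<subseteq> UNIV" "majority UNIV a b c = extend_family UNIV ?Y (majority ?Y a b c)"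
    unfolding majority_def extend_family_def by auto
  moreover have "majority ?Y a b c \<in> max_linked ?Y" by (simp add: majority_max_linked)
  moreover have "finite ?Y" "card ?Y \<le> 3" by (simp_all add: card_insert_if)
  ultimately show ?thesis
    using majority_max_linked[of a UNIV b c] unfolding max_linked_3_def by blast
qed

text \<open>Over a finite \<open>Y\<close> the family \<open>\<F>\<close> is itself a finite
  collection of finite sets, and it generates its own extension to \<open>X\<close>.\<close>

lemma max_linked_3_subset_max_linked_fin: "max_linked_3 X \<subseteq> max_linked_fin X"
proof
  fix \<A> assume "\<A> \<in> max_linked_3 X"
  then obtain Y \<F> where \<A>: "\<A> \<in> max_linked X" and Y: "Y \<subseteq> X" "finite Y"
    and \<F>: "\<F> \<in> max_linked Y" "\<A> = extend_family X Y \<F>"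
    unfolding max_linked_3_def by blast
  have up: "\<F> \<in> upfamilies Y" using \<F>(1) by (rule max_linked_imp_upfamilies)
  have sub: "\<F> \<subseteq> Pow Y" using up unfolding upfamilies_def by blast
  have "\<A> = upfamily_generated X \<F>"
  proof
    show "\<A> \<subseteq> upfamily_generated X \<F>"
      unfolding \<F>(2) extend_family_def upfamily_generated_def by blast
    show "upfamily_generated X \<F> \<subseteq> \<A>"
    proof
      fix E assume "E \<in> upfamily_generated X \<F>"
      then obtain G where "G \<in> \<F>" "G \<subseteq> E" "E \<subseteq> X"
        unfolding upfamily_generated_def by blast
      then have "E \<inter> Y \<in> \<F>" using upfamiliesD_mono[OF up, of G "E \<inter> Y"] sub by blast
      then show "E \<in> \<A>" using \<open>E \<subseteq> X\<close> unfolding \<F>(2) extend_family_def by blast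
    qed
  qed
  moreover have "finite \<F>" using sub Y(2) by (meson finite_Pow_iff finite_subset)
  moreover have "\<F> \<noteq> {}" "\<forall>G\<in>\<F>. finite G \<and> G \<noteq> {} \<and> G \<subseteq> X"
    using up Y unfolding upfamilies_def by (blast intro: finite_subset)+
  ultimately have "finitely_supported X \<A>" unfolding finitely_supported_def by blast
  then show "\<A> \<in> max_linked_fin X" using \<A> unfolding max_linked_fin_def by blast
qed

section \<open>From failure of commutativity to disjoint products, and back\<close>

lemma not_iterated_imp_pattern:
  fixes P :: "'a \<Rightarrow> 'b \<Rightarrow> bool"
  assumes A: "\<A> \<in> max_linked_fin UNIV" and B: "\<B> \<in> max_linked UNIV"
    and pos: "{a. {b. P a b} \<in> \<B>} \<in> \<A>" and neg: "{b. {a. \<not> P a b} \<in> \<A>} \<in> \<B>"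
  obtains a b c x y z where "P a x" "P a y" "P c y" "P c z"
    "\<not> P c x" "\<not> P b x" "\<not> P a z" "\<not> P b z"
proof -
  have A': "\<A> \<in> max_linked UNIV" using A unfolding max_linked_fin_def by blast
  \<comment> \<open>Finite support enters here: inside a finite \<open>F\<close>, a proper inclusion
    of traces lowers the cardinality.\<close>
  obtain F where F: "finite F" "F \<subseteq> {a. {b. P a b} \<in> \<B>}" "F \<in> \<A>"
    using max_linked_fin_finite_subset[OF A pos] by blast
  define B0 where "B0 = {b. {a. \<not> P a b} \<in> \<A>}"
  have B0: "B0 \<in> \<B>" using neg unfolding B0_def .
  define N where "N b = {a. \<not> P a b} \<inter> F" for b
  obtain x0 where "x0 \<in> B0" using max_linked_Int_nonempty[OF B B0 B0] by blast
  then obtain x where x: "x \<in> B0" and least: "\<And>z. z \<in> B0 \<Longrightarrow> card (N x) \<le> card (N z)"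
    using ex_has_least_nat[of "\<lambda>b. b \<in> B0" x0 "\<lambda>b. card (N b)"] by blast
  \<comment> \<open>As \<open>x\<close> lies in \<open>B0\<close>, its exceptions form a member of
    \<open>\<A>\<close>, which must meet \<open>F\<close>.\<close>
  obtain c where c: "c \<in> N x"
    using max_linked_Int_nonempty[OF A' _ F(3)] x unfolding B0_def N_def by blast
  then have cB: "{b. P c b} \<in> \<B>" using F(2) unfolding N_def by blast
  obtain z where z: "z \<in> B0" "P c z" using max_linked_Int_nonempty[OF B cB B0] by blast
  have "\<not> N z \<subseteq> N x"
  proof
    assume "N z \<subseteq> N x"
    \<comment> \<open>The inclusion is proper because \<open>c\<close> is an exception for
      \<open>x\<close> but not for \<open>z\<close>.\<close>
    then have "N z \<subset> N x" using c z(2) unfolding N_def by blast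
    then have "card (N z) < card (N x)" using F(1) by (auto simp: N_def intro: psubset_card_mono)
    then show False using least[OF z(1)] by simp
  qed
  \<comment> \<open>Since \<open>a\<close> lies in \<open>F\<close>, being outside
    \<open>N x\<close> means \<open>P a x\<close>, while \<open>P a z\<close> fails.\<close>
  then obtain a where a: "a \<in> N z" "a \<notin> N x" by blast
  then have aB: "{b. P a b} \<in> \<B>" using F(2) unfolding N_def by blast
  obtain y where y: "P a y" "P c y" using max_linked_Int_nonempty[OF B aB cB] by blast
  have "{a. \<not> P a x} \<in> \<A>" "{a. \<not> P a z} \<in> \<A>" using x z(1) unfolding B0_def by simp_all
  then obtain b where b: "\<not> P b x" "\<not> P b z" using max_linked_Int_nonempty[OF A'] by blast
  show thesis
    using a b c y z(2) by (intro that[of a x y c z b]) (auto simp: N_def)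
qed

lemma disjoint_products_if_not_commute:
  fixes \<A> \<B> :: "'a::ab_semigroup_mult set set"
  assumes A: "\<A> \<in> max_linked_fin UNIV" and B: "\<B> \<in> max_linked UNIV"
    and neq: "\<A> \<star> \<B> \<noteq> \<B> \<star> \<A>"
  obtains a b c x y z :: 'a
  where "{a * x, a * y, c * y, c * z} \<inter> {x * c, x * b, z * a, z * b} = {}"
proof -
  have A': "\<A> \<in> max_linked UNIV" using A unfolding max_linked_fin_def by blast
  note iff = mem_upfamily_mult_iff[OF max_linked_imp_upfamilies max_linked_imp_upfamilies]
  obtain U where U: "U \<in> \<A> \<star> \<B>" "- U \<in> \<B> \<star> \<A>"
  proof -
    \<comment> \<open>A set separating the products works as \<open>U\<close> if it lies in
      \<open>\<A> \<star> \<B>\<close>; otherwise its complement does.\<close>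
    obtain V where "V \<in> \<A> \<star> \<B> \<longleftrightarrow> V \<notin> \<B> \<star> \<A>" using neq by blast
    then show thesis
      using that[of V] that[of "- V"] Compl_mem_upfamily_mult_iff[OF A' B, of V]
        Compl_mem_upfamily_mult_iff[OF B A', of V] by auto
  qed
  have pos: "{a. {b. a * b \<in> U} \<in> \<B>} \<in> \<A>" using U(1) iff[OF A' B] by blast
  \<comment> \<open>Commutativity of the semigroup makes both iterated statements concern the one
    relation \<open>a * b \<in> U\<close>.\<close>
  have neg: "{b. {a. a * b \<notin> U} \<in> \<A>} \<in> \<B>"
    using U(2) iff[OF B A'] by (simp add: mult.commute)
  obtain a b c x y z :: 'a where "a * x \<in> U" "a * y \<in> U" "c * y \<in> U" "c * z \<in> U"
    "c * x \<notin> U" "b * x \<notin> U" "a * z \<notin> U" "b * z \<notin> U"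
    by (rule not_iterated_imp_pattern[OF A B pos neg])
  then have "{a * x, a * y, c * y, c * z} \<subseteq> U" "{x * c, x * b, z * a, z * b} \<subseteq> - U"
    by (simp_all add: mult.commute)
  then show thesis by (intro that[of a x y c z b]) blast
qed

lemma not_disjoint_products_if_majority_commute:
  fixes a b c x y z :: "'a::times"
  assumes comm: "majority UNIV a b c \<star> majority UNIV x y z = majority UNIV x y z \<star> majority UNIV a b c"
  shows "{a * x, a * y, c * y, c * z} \<inter> {x * c, x * b, z * a, z * b} \<noteq> {}"
proof
  let ?A = "majority UNIV a b c" and ?B = "majority UNIV x y z"
  let ?U = "{a * x, a * y, c * y, c * z}"
  assume disj: "?U \<inter> {x * c, x * b, z * a, z * b} = {}"
  have A: "?A \<in> max_linked UNIV" and B: "?B \<in> max_linked UNIV"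
    by (simp_all add: majority_max_linked)
  note iff = mem_upfamily_mult_iff[OF max_linked_imp_upfamilies max_linked_imp_upfamilies]
  \<comment> \<open>The outer pair is \<open>a\<close>, \<open>c\<close>, with fibres containing
    \<open>{x, y}\<close> and \<open>{y, z}\<close> respectively.\<close>
  have "?U \<in> ?A \<star> ?B"
    unfolding iff[OF A B] by (simp add: majority_def)
  \<comment> \<open>In the other order the outer pair is \<open>x\<close>, \<open>z\<close>, with
    fibres containing \<open>{c, b}\<close> and \<open>{a, b}\<close>.\<close>
  moreover have "- ?U \<in> ?B \<star> ?A"
    using disj unfolding iff[OF B A] by (simp add: majority_def)
  ultimately show False
    using Compl_mem_upfamily_mult_iff[OF A B] comm by blast
qed

section \<open>The cycle (1), (2), (4), (3), (1), with (5) attached to (4)\<close>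

lemma all_equivalent_5I:
  assumes "P1 \<Longrightarrow> P2" "P2 \<Longrightarrow> P4" "P4 \<Longrightarrow> P3" "P3 \<Longrightarrow> P1" "P4 \<longleftrightarrow> P5"
  shows "all_equivalent [P1, P2, P3, P4, P5]"
  using assms unfolding all_equivalent_def by auto

theorem theorem9p2:
  "all_equivalent
    [\<forall>\<A> \<in> max_linked_fin (UNIV :: 'a::ab_semigroup_mult set).
       \<forall>\<B> \<in> max_linked_fin (UNIV :: 'a set). \<A> \<star> \<B> = \<B> \<star> \<A>,
     \<forall>\<A> \<in> max_linked_3 (UNIV :: 'a set).
       \<forall>\<B> \<in> max_linked_3 (UNIV :: 'a set). \<A> \<star> \<B> = \<B> \<star> \<A>,
     \<forall>\<A> \<in> max_linked_fin (UNIV :: 'a set).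
       \<forall>\<B> \<in> max_linked (UNIV :: 'a set). \<A> \<star> \<B> = \<B> \<star> \<A>,
     \<forall>a b c x y z :: 'a.
       {a * x, a * y, c * y, c * z} \<inter> {x * c, x * b, z * a, z * b} \<noteq> {},
     \<forall>x0 x1 x2 x3 x4 x5 :: 'a.
       {x1 * x2, x2 * x3, x3 * x4, x4 * x5} \<inter> {x1 * x4, x2 * x5, x0 * x1, x0 * x5} \<noteq> {}]"
proof -
  let "all_equivalent [?P1, ?P2, ?P3, ?P4, ?P5]" = ?thesis
  show ?thesis
  proof (rule all_equivalent_5I)
    assume P1: ?P1
    show ?P2
    proof (intro ballI)
      fix \<A> \<B> :: "'a set set"
      assume "\<A> \<in> max_linked_3 UNIV" "\<B> \<in> max_linked_3 UNIV"
      then show "\<A> \<star> \<B> = \<B> \<star> \<A>"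
        by (intro P1[rule_format] subsetD[OF max_linked_3_subset_max_linked_fin])
    qed
  next
    assume P2: ?P2
    show ?P4
      by (intro allI not_disjoint_products_if_majority_commute P2[rule_format]
          majority_max_linked_3)
  next
    assume P4: ?P4
    show ?P3
    proof (intro ballI, rule ccontr)
      fix \<A> \<B> :: "'a set set"
      assume "\<A> \<in> max_linked_fin UNIV" "\<B> \<in> max_linked UNIV" "\<A> \<star> \<B> \<noteq> \<B> \<star> \<A>"
      then obtain a b c x y z :: 'a
        where "{a * x, a * y, c * y, c * z} \<inter> {x * c, x * b, z * a, z * b} = {}"
        by (rule disjoint_products_if_not_commute)
      then show False by (rule P4[rule_format, THEN notE])
    qed
  next
    assume P3: ?P3
    show ?P1
    proof (intro ballI)
      fix \<A> \<B> :: "'a set set"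
      assume "\<A> \<in> max_linked_fin UNIV" "\<B> \<in> max_linked_fin UNIV"
      then show "\<A> \<star> \<B> = \<B> \<star> \<A>"
        unfolding max_linked_fin_def by (intro P3[rule_format]) (simp_all add: max_linked_fin_def)
    qed
  next
    show "?P4 \<longleftrightarrow> ?P5"
    proof -
      \<comment> \<open>Up to commutativity, (5) is (4) with \<open>x0, x1, x2, x3, x4, x5\<close>
        standing for \<open>b, x, a, y, c, z\<close>.\<close>
      have *: "{a * x, a * y, c * y, c * z} \<inter> {x * c, x * b, z * a, z * b} =
          {x * a, a * y, y * c, c * z} \<inter> {x * c, a * z, b * x, b * z}" for a b c x y z :: 'a
        by (simp only: mult.commute insert_commute)
      show ?thesis
      proof (intro iffI allI)
        fix x0 x1 x2 x3 x4 x5 :: 'a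
        assume P4: ?P4
        show "{x1 * x2, x2 * x3, x3 * x4, x4 * x5} \<inter> {x1 * x4, x2 * x5, x0 * x1, x0 * x5} \<noteq> {}"
          unfolding *[of x2 x1 x3 x4 x5 x0, symmetric] by (intro P4[rule_format])
      next
        fix a b c x y z :: 'a
        assume P5: ?P5
        show "{a * x, a * y, c * y, c * z} \<inter> {x * c, x * b, z * a, z * b} \<noteq> {}"
          unfolding *[of a x y c z b] by (intro P5[rule_format])
      qed
    qed
  qed
qed

end
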